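(* Let $\mathrm{LP}(A,b,c)$ be a linear program such that $P(A,b)$ is bounded and full-dimensional, and let $\Gamma=\langle\gamma_1,\dots,\gamma_t\rangle$ be a finite subgroup of $\mathrm{Aut}(\mathrm{LP}(A,b,c))$. Let $E$ be a real matrix with $\{x\in\mathbb{R}^n : Ex=0\}=\mathrm{Fix}_\Gamma(\mathbb{R}^n)$. Let $(A'|b')$ be the extended matrix having one row for each $\Gamma$-orbit on the set of rows of $(A|b)$, namely the sum of the rows in that orbit. Then the polyhedron \[ P' = \{x\in\mathbb{R}^n : A'x\le b',\ Ex=0\} \] equals the set $\mathrm{Fix}_\Gamma(P(A,b))$ of points of $P(A,b)$ fixed by every element of $\Gamma$. In particular, $P'=\{\beta(\Gamma x) : x\in P(A,b)\}$. Moreover, each optimal solution of the linear program \[ \max\ c^tx \quad\text{s.t.}\quad \begin{pmatrix} A'\\ E\\ -E\end{pmatrix}x\le\begin{pmatrix} b'\\ 0\\ 0\end{pmatrix},\quad x\in\mathbb{R}^n \] is an optimal solution of $\mathrm{LP}(A,b,c)$, and the optimal objective values of the two linear programs are the same.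
   Context: For $A\in\mathbb{R}^{m\times n}$ without zero rows, $b\in\mathbb{R}^m$ and $c\in\mathbb{R}^n\setminus\{0\}$, $\mathrm{LP}(A,b,c)$ is the linear program $\max\{c^tx : Ax\le b,\ x\in\mathbb{R}^n\}$. The set of feasible points is $P(A,b)=\{x\in\mathbb{R}^n : Ax\le b\}$; it is assumed to be non-empty and $\mathrm{LP}(A,b,c)$ is assumed to have an optimal solution. The arrangement $\mathscr{H}(A,b)$ consists of the $m$ affine hyperplanes $\{x : a_{i,\cdot}x=b_i\}$, where $a_{i,\cdot}$ is the $i$-th row of $A$; it is assumed that the rows of the extended matrix $(A|b)$ are in one-to-one correspondence with these hyperplanes. An automorphism of $\mathrm{LP}(A,b,c)$ is a linear transformation in $\mathrm{GL}_n\mathbb{R}$ which induces a permutation of $\mathscr{H}(A,b)$, leaves $P(A,b)$ invariant, and does not change the objective value $c^tx$ of any $x\in P(A,b)$. These form the group $\mathrm{Aut}(\mathrm{LP}(A,b,c))$. The rows of $(A|b)$ are scaled (by positive factors) such that $\Gamma$ acts on the set of rows of $(A|b)$: for each $\gamma\in\Gamma$ and each row $(a|\beta)$ of $(A|b)$, the vector $(a\gamma^{-1}|\beta)$ is again a row of $(A|b)$. For a set $Y\subseteq\mathbb{R}^n$ on which $\Gamma$ acts, $\mathrm{Fix}_\Gamma(Y)=\{y\in Y : \gamma y=y \text{ for all }\gamma\in\Gamma\}$. For a finite non-empty set $S\subset\mathbb{R}^n$, $\beta(S)=\frac{1}{|S|}\sum_{v\in S}v$ is its barycenter, and $\Gamma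 x$ denotes the $\Gamma$-orbit of $x$. *)

theory Defs
  imports "HOL-Analysis.Analysis" "HOL-Algebra.Generated_Groups"
begin

subsection \<open>Linear programs\<close>

text \<open>The order on \<^typ>\<open>real ^ 'm\<close> is componentwise.\<close>

definition feasible :: "real ^ 'n ^ 'm \<Rightarrow> real ^ 'm \<Rightarrow> (real ^ 'n) set" where
  "feasible A b = {x. A *v x \<le> b}"

definition optimal_solution :: "real ^ 'n ^ 'm \<Rightarrow> real ^ 'm \<Rightarrow> real ^ 'n \<Rightarrow> real ^ 'n \<Rightarrow> bool" where
  "optimal_solution A b c x \<longleftrightarrow>
     x \<in> feasible A b \<and> (\<forall>y \<in> feasible A b. c \<bullet> y \<le> c \<bullet> x)"

text \<open>The supremum is only meaningful (and then a maximum) if an optimal solution exists.\<close>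

definition optimal_value :: "real ^ 'n ^ 'm \<Rightarrow> real ^ 'm \<Rightarrow> real ^ 'n \<Rightarrow> real" where
  "optimal_value A b c = (SUP x \<in> feasible A b. c \<bullet> x)"

text \<open>Vertical stacking. A matrix is a vector of rows, so the same operation stacks
  matrices (\<open>'a\<close> is the type of rows) and column vectors (\<open>'a\<close> is the type of scalars).\<close>

definition vstack :: "'a ^ 'k \<Rightarrow> 'a ^ 'l \<Rightarrow> 'a ^ ('k::finite + 'l::finite)" (infixr "above" 65) where
  "u above v = (\<chi> i. case i of Inl j \<Rightarrow> u $ j | Inr j \<Rightarrow> v $ j)"

subsection \<open>Hyperplane arrangement and automorphisms\<close>

definition row_hyperplane :: "real ^ 'n ^ 'm \<Rightarrow> real ^ 'm \<Rightarrow> 'm \<Rightarrow> (real ^ 'n) set" where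
  "row_hyperplane A b i = {x. row i A \<bullet> x = b $ i}"

definition arrangement :: "real ^ 'n ^ 'm \<Rightarrow> real ^ 'm \<Rightarrow> (real ^ 'n) set set" where
  "arrangement A b = range (row_hyperplane A b)"

definition GL :: "(real ^ 'n ^ 'n) monoid" where
  "GL = \<lparr>carrier = {M. invertible M}, mult = (**), one = mat 1\<rparr>"

definition LP_automorphism ::
    "real ^ 'n ^ 'm \<Rightarrow> real ^ 'm \<Rightarrow> real ^ 'n \<Rightarrow> real ^ 'n ^ 'n \<Rightarrow> bool" where
  "LP_automorphism A b c M \<longleftrightarrow>
     invertible M \<and>
     bij_betw (\<lambda>H. (*v) M ` H) (arrangement A b) (arrangement A b) \<and>
     (*v) M ` feasible A b = feasible A b \<and>
     (\<forall>x \<in> feasible A b. c \<bullet> (M *v x) = c \<bullet> x)"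

definition LP_Aut :: "real ^ 'n ^ 'm \<Rightarrow> real ^ 'm \<Rightarrow> real ^ 'n \<Rightarrow> (real ^ 'n ^ 'n) monoid" where
  "LP_Aut A b c = GL\<lparr>carrier := {M. LP_automorphism A b c M}\<rparr>"

subsection \<open>Fixed points and barycenters\<close>

definition fixed_points :: "(real ^ 'n ^ 'n) set \<Rightarrow> (real ^ 'n) set \<Rightarrow> (real ^ 'n) set" where
  "fixed_points \<Gamma> Y = {y \<in> Y. \<forall>M \<in> \<Gamma>. M *v y = y}"

definition point_orbit :: "(real ^ 'n ^ 'n) set \<Rightarrow> real ^ 'n \<Rightarrow> (real ^ 'n) set" where
  "point_orbit \<Gamma> x = (\<lambda>M. M *v x) ` \<Gamma>"

definition barycenter :: "(real ^ 'n) set \<Rightarrow> real ^ 'n" where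
  "barycenter S = (1 / real (card S)) *\<^sub>R (\<Sum>v \<in> S. v)"

subsection \<open>Rows of the extended matrix\<close>

text \<open>A row \<open>(a|\<beta>)\<close> of \<open>(A|b)\<close> is a pair; pairs are added componentwise.\<close>

definition ext_row :: "real ^ 'n ^ 'm \<Rightarrow> real ^ 'm \<Rightarrow> 'm \<Rightarrow> (real ^ 'n) \<times> real" where
  "ext_row A b i = (row i A, b $ i)"

definition ext_rows :: "real ^ 'n ^ 'm \<Rightarrow> real ^ 'm \<Rightarrow> ((real ^ 'n) \<times> real) set" where
  "ext_rows A b = range (ext_row A b)"

definition row_act :: "real ^ 'n ^ 'n \<Rightarrow> (real ^ 'n) \<times> real \<Rightarrow> (real ^ 'n) \<times> real" where
  "row_act M r = (fst r v* matrix_inv M, snd r)"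

definition row_orbit ::
    "(real ^ 'n ^ 'n) set \<Rightarrow> (real ^ 'n) \<times> real \<Rightarrow> ((real ^ 'n) \<times> real) set" where
  "row_orbit \<Gamma> r = (\<lambda>M. row_act M r) ` \<Gamma>"

definition row_orbits ::
    "(real ^ 'n ^ 'n) set \<Rightarrow> real ^ 'n ^ 'm \<Rightarrow> real ^ 'm \<Rightarrow> ((real ^ 'n) \<times> real) set set" where
  "row_orbits \<Gamma> A b = row_orbit \<Gamma> ` ext_rows A b"

text \<open>The rows of \<open>(A'|b')\<close> are indexed, in some order, by the orbits of rows of \<open>(A|b)\<close>,
  and each row is the sum of the rows in its orbit.\<close>

definition orbit_sum_system ::
    "(real ^ 'n ^ 'n) set \<Rightarrow> real ^ 'n ^ 'm \<Rightarrow> real ^ 'm \<Rightarrow>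
     real ^ 'n ^ 'k \<Rightarrow> real ^ 'k \<Rightarrow> bool" where
  "orbit_sum_system \<Gamma> A b A' b' \<longleftrightarrow>
     (\<exists>orb. bij_betw orb (UNIV :: 'k set) (row_orbits \<Gamma> A b) \<and>
            (\<forall>j. ext_row A' b' j = (\<Sum>r \<in> orb j. r)))"

subsection \<open>The automorphisms form a group\<close>

lemma invertible_mat_1: "invertible (mat 1 :: real ^ 'n ^ 'n)"
  by (auto simp: invertible_def)

lemma
  fixes M :: "real ^ 'n ^ 'n"
  assumes "invertible M"
  shows matrix_inv_right: "M ** matrix_inv M = mat 1"
    and matrix_inv_left: "matrix_inv M ** M = mat 1"
  using someI_ex[OF assms[unfolded invertible_def]] by (auto simp: matrix_inv_def)

lemma group_GL: "group GL"
proof (rule groupI)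
  fix x :: "real ^ 'n ^ 'n" assume "x \<in> carrier GL"
  then show "\<exists>y \<in> carrier GL. y \<otimes>\<^bsub>GL\<^esub> x = \<one>\<^bsub>GL\<^esub>"
    by (auto simp: GL_def invertible_def)
qed (auto simp: GL_def invertible_mult matrix_mul_assoc invertible_mat_1)

lemma inv_GL:
  assumes "invertible M" shows "inv\<^bsub>GL\<^esub> M = matrix_inv M"
proof (rule group.inv_equality[OF group_GL])
  show "matrix_inv M \<otimes>\<^bsub>GL\<^esub> M = \<one>\<^bsub>GL\<^esub>" "M \<in> carrier GL"
    using assms by (auto simp: GL_def matrix_inv_left)
  show "matrix_inv M \<in> carrier GL"
    using matrix_inv_left[OF assms] matrix_inv_right[OF assms] by (auto simp: GL_def invertible_def)
qed

lemma LP_automorphism_mult: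
  assumes "LP_automorphism A b c M" "LP_automorphism A b c N"
  shows "LP_automorphism A b c (M ** N)"
proof -
  have *: "(*v) (M ** N) = (*v) M \<circ> (*v) N"
    by (auto simp: matrix_vector_mul_assoc)
  have "bij_betw (\<lambda>H. (*v) (M ** N) ` H) (arrangement A b) (arrangement A b)"
    using bij_betw_trans[of "\<lambda>H. (*v) N ` H" "arrangement A b" "arrangement A b"
        "\<lambda>H. (*v) M ` H" "arrangement A b"] assms
    unfolding LP_automorphism_def * by (simp add: comp_def image_image)
  moreover have "(*v) (M ** N) ` feasible A b = feasible A b"
    using assms unfolding LP_automorphism_def * by (metis image_comp)
  moreover have "\<forall>x \<in> feasible A b. c \<bullet> ((M ** N) *v x) = c \<bullet> x"
    using assms unfolding LP_automorphism_def * by (auto simp: image_iff) (metis imageI)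
  ultimately show ?thesis
    using assms by (auto simp: LP_automorphism_def invertible_mult)
qed

lemma LP_automorphism_matrix_inv:
  assumes "LP_automorphism A b c M"
  shows "LP_automorphism A b c (matrix_inv M)"
proof -
  let ?N = "matrix_inv M"
  have inv: "invertible M" using assms by (simp add: LP_automorphism_def)
  have NM: "?N *v (M *v x) = x" and MN: "M *v (?N *v x) = x" for x
    using inv by (simp_all add: matrix_vector_mul_assoc matrix_inv_left matrix_inv_right)
  have img: "(*v) ?N ` ((*v) M ` H) = H" "(*v) M ` ((*v) ?N ` H) = H" for H
    by (simp_all add: image_image NM MN)
  have bij: "bij_betw (\<lambda>H. (*v) M ` H) (arrangement A b) (arrangement A b)"
    and feas: "(*v) M ` feasible A b = feasible A b"
    and obj: "\<forall>x \<in> feasible A b. c \<bullet> (M *v x) = c \<bullet> x"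
    using assms by (auto simp: LP_automorphism_def)
  have "(\<lambda>H. (*v) M ` H) ` arrangement A b = arrangement A b"
    using bij by (simp add: bij_betw_def)
  then have "bij_betw (\<lambda>H. (*v) ?N ` H) (arrangement A b) (arrangement A b)"
    by (intro bij_betw_byWitness[where f' = "\<lambda>H. (*v) M ` H"])
      (auto simp: img image_subset_iff, metis (no_types, lifting) image_iff img(1))
  moreover have fN: "(*v) ?N ` feasible A b = feasible A b"
    using feas img(1)[of "feasible A b"] by simp
  moreover have "\<forall>x \<in> feasible A b. c \<bullet> (?N *v x) = c \<bullet> x"
    using obj fN MN by (metis imageI)
  moreover have "invertible ?N"
    using matrix_inv_left[OF inv] matrix_inv_right[OF inv] by (auto simp: invertible_def)
  ultimately show ?thesis by (simp add: LP_automorphism_def)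
qed

lemma subgroup_LP_Aut: "subgroup (carrier (LP_Aut A b c)) GL"
proof (rule group.subgroupI[OF group_GL])
  have "LP_automorphism A b c (mat 1)"
    by (auto simp: LP_automorphism_def invertible_def matrix_mul_lid bij_betw_def)
  then show "carrier (LP_Aut A b c) \<noteq> {}" by (auto simp: LP_Aut_def)
next
  fix M assume "M \<in> carrier (LP_Aut A b c)"
  then show "inv\<^bsub>GL\<^esub> M \<in> carrier (LP_Aut A b c)"
    using LP_automorphism_matrix_inv[of A b c M] inv_GL[of M]
    by (simp add: LP_Aut_def LP_automorphism_def)
next
  fix M N assume "M \<in> carrier (LP_Aut A b c)" "N \<in> carrier (LP_Aut A b c)"
  then show "M \<otimes>\<^bsub>GL\<^esub> N \<in> carrier (LP_Aut A b c)"
    using LP_automorphism_mult[of A b c M N] by (simp add: LP_Aut_def GL_def)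
qed (auto simp: LP_Aut_def GL_def LP_automorphism_def)

lemma group_LP_Aut: "group (LP_Aut A b c)"
  using group.subgroup_imp_group[OF group_GL subgroup_LP_Aut[of A b c]]
  by (simp add: LP_Aut_def)

end

theory Submission
  imports Defs
begin

text \<open>A row \<open>a\<close> and its translates \<open>a \<gamma>\<^sup>-\<^sup>1\<close> take the same value at a \<open>\<Gamma>\<close>-fixed point, so on fixed
  points each inequality of \<open>(A'|b')\<close> is a positive multiple of every inequality in its orbit.
  The barycenter of an orbit \<open>\<Gamma>x\<close> is fixed, and by convexity it is feasible with the same
  objective value as \<open>x\<close>. Hence restricting to fixed points loses no optimal value.\<close>

lemma feasible_iff_ext_rows: "x \<in> feasible A b \<longleftrightarrow> (\<forall>r \<in> ext_rows A b. fst r \<bullet> x \<le> snd r)"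
  by (auto simp: feasible_def less_eq_vec_def matrix_vector_mul_component ext_rows_def
      ext_row_def row_def vec_nth_inverse)

lemma convex_feasible: "convex (feasible A b)"
proof -
  have "feasible A b = (\<Inter>r \<in> ext_rows A b. {x. fst r \<bullet> x \<le> snd r})"
    by (simp add: set_eq_iff feasible_iff_ext_rows)
  then show ?thesis
    by (simp add: convex_INT convex_halfspace_le)
qed

lemma feasible_vstack: "feasible (A above B) (a above b) = feasible A a \<inter> feasible B b"
proof -
  have "x \<in> feasible (A above B) (a above b) \<longleftrightarrow> x \<in> feasible A a \<inter> feasible B b" for x
  proof
    assume "x \<in> feasible (A above B) (a above b)"
    then have *: "((A above B) *v x) $ i \<le> (a above b) $ i" for i
      by (simp add: feasible_def less_eq_vec_def)
    show "x \<in> feasible A a \<inter> feasible B b"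
      using *[of "Inl _"] *[of "Inr _"]
      by (simp add: feasible_def less_eq_vec_def matrix_vector_mul_component vstack_def)
  next
    assume "x \<in> feasible A a \<inter> feasible B b"
    then show "x \<in> feasible (A above B) (a above b)"
      by (auto simp: feasible_def less_eq_vec_def matrix_vector_mul_component vstack_def
          split: sum.split)
  qed
  then show ?thesis by blast
qed

text \<open>The two blocks bound \<open>E *v x\<close> by zero from above and from below, and
  antisymmetry in each component makes this an equation. Since \<open>above\<close> associates to
  the right, the system here is exactly the tail of the stacked program.\<close>

lemma feasible_eq_zero: "feasible (E above - E) (0 above 0) = {x. E *v x = 0}"
proof -
  have "(- E) *v x = - (E *v x)" for x
    using matrix_vector_mult_diff_rdistrib[of 0 E x] by simp
  then show ?thesis
    unfolding feasible_vstack set_eq_iff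
    by (auto simp: feasible_def less_eq_vec_def vec_eq_iff intro: order_antisym)
qed

text \<open>An optimal solution attains the supremum. Equality of two optimal values thus reduces to
  exhibiting one point that is optimal for both programs.\<close>

lemma optimal_value_eq:
  assumes "optimal_solution A b c x" shows "optimal_value A b c = c \<bullet> x"
  unfolding optimal_value_def
  using assms by (intro cSup_eq_maximum) (auto simp: optimal_solution_def)

text \<open>The inverse of \<open>M\<close> fixes \<open>x\<close> as well, and in the inner product
  it moves from the row over to \<open>x\<close>.\<close>

lemma row_act_fixed:
  assumes "invertible M" "M *v x = x"
  shows "fst (row_act M r) \<bullet> x = fst r \<bullet> x"
proof -
  have "matrix_inv M *v x = x"
    using assms by (metis matrix_inv_left matrix_vector_mul_assoc matrix_vector_mul_lid)
  then show ?thesis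
    by (simp add: row_act_def dot_lmul_matrix)
qed

text \<open>At a fixed point all rows of an orbit impose the same inequality. Their sum is that
  inequality multiplied by the size of the orbit, a positive number that cancels.\<close>

lemma row_orbit_sum_le_iff:
  assumes "finite \<Gamma>" "\<Gamma> \<noteq> {}" "\<forall>M \<in> \<Gamma>. invertible M" "\<forall>M \<in> \<Gamma>. M *v x = x"
  shows "fst (\<Sum>s \<in> row_orbit \<Gamma> r. s) \<bullet> x \<le> snd (\<Sum>s \<in> row_orbit \<Gamma> r. s)
    \<longleftrightarrow> fst r \<bullet> x \<le> snd r"
proof -
  let ?O = "row_orbit \<Gamma> r"
  have "fst s \<bullet> x = fst r \<bullet> x" "snd s = snd r" if "s \<in> ?O" for s
    using that assms(3,4) by (auto simp: row_orbit_def row_act_fixed) (simp add: row_act_def)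
  then have "fst (\<Sum>s \<in> ?O. s) \<bullet> x = real (card ?O) * (fst r \<bullet> x)"
    and "snd (\<Sum>s \<in> ?O. s) = real (card ?O) * snd r"
    by (simp_all add: fst_sum snd_sum inner_sum_left)
  moreover have "card ?O > 0"
    using assms(1,2) by (simp add: row_orbit_def card_gt_0_iff)
  ultimately show ?thesis by simp
qed

lemma feasible_orbit_sum_system:
  assumes "orbit_sum_system \<Gamma> A b A' b'"
    and "finite \<Gamma>" "\<Gamma> \<noteq> {}" "\<forall>M \<in> \<Gamma>. invertible M" "\<forall>M \<in> \<Gamma>. M *v x = x"
  shows "x \<in> feasible A' b' \<longleftrightarrow> x \<in> feasible A b"
proof -
  obtain orb where orb: "range orb = row_orbits \<Gamma> A b"
    and row: "\<And>j. ext_row A' b' j = (\<Sum>r \<in> orb j. r)"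
    using assms(1) by (auto simp: orbit_sum_system_def bij_betw_def)
  \<comment> \<open>Summing over each orbit on both sides of \<open>orb\<close> trades the row
    indices of \<open>A'\<close> for the rows of \<open>(A|b)\<close>.\<close>
  have "ext_rows A' b' = (\<lambda>r. \<Sum>s \<in> row_orbit \<Gamma> r. s) ` ext_rows A b"
    using arg_cong[OF orb, of "(`) (\<lambda>S. \<Sum>r \<in> S. r)"]
    by (simp add: ext_rows_def[of A'] row row_orbits_def image_image)
  then show ?thesis
    by (simp add: feasible_iff_ext_rows row_orbit_sum_le_iff[OF assms(2-5)])
qed

text \<open>\<open>M\<close> permutes the points of the orbit; being linear, it therefore only
  reorders the sum that defines the barycenter. The orbit is a set, so each point counts once
  however many elements of \<open>\<Gamma>\<close> reach it.\<close>

lemma barycenter_fixed: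
  assumes "finite \<Gamma>" "\<forall>M \<in> \<Gamma>. \<forall>N \<in> \<Gamma>. M ** N \<in> \<Gamma>" "M \<in> \<Gamma>" "invertible M"
  shows "M *v barycenter (point_orbit \<Gamma> x) = barycenter (point_orbit \<Gamma> x)"
proof -
  let ?S = "point_orbit \<Gamma> x"
  have inj: "inj_on ((*v) M) ?S"
    using assms(4) by (intro inj_on_inverseI[where g = "(*v) (matrix_inv M)"])
      (simp add: matrix_vector_mul_assoc matrix_inv_left)
  have "(*v) M ` ?S \<subseteq> ?S"
    using assms(2,3) by (auto simp: point_orbit_def matrix_vector_mul_assoc)
  \<comment> \<open>An injective self-map of a finite set is onto.\<close>
  then have "(*v) M ` ?S = ?S"
    using assms(1) inj by (intro endo_inj_surj) (auto simp: point_orbit_def)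
  then have "(\<Sum>v \<in> ?S. M *v v) = (\<Sum>v \<in> ?S. v)"
    using sum.reindex[OF inj, of "\<lambda>v. v"] by (simp add: comp_def)
  then show ?thesis
    by (simp add: barycenter_def matrix_vector_mult_scaleR
        linear_sum[OF matrix_vector_mul_linear])
qed

text \<open>The barycenter is the convex combination with equal weights
  \<open>1 / card S\<close>.\<close>

lemma barycenter_mem_convex:
  assumes "convex C" "finite S" "S \<noteq> {}" "S \<subseteq> C"
  shows "barycenter S \<in> C"
proof -
  have "(\<Sum>v \<in> S. (1 / real (card S)) *\<^sub>R v) \<in> C"
    using assms by (intro convex_sum) auto
  then show ?thesis by (simp add: barycenter_def scaleR_sum_right)
qed

lemma inner_barycenter:
  assumes "finite S" "S \<noteq> {}" "\<And>v. v \<in> S \<Longrightarrow> c \<bullet> v = d"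
  shows "c \<bullet> barycenter S = d"
  using assms by (simp add: barycenter_def inner_sum_right)

text \<open>The orbit collapses to the single point \<open>x\<close>. This yields the inclusion of
  the fixed points in the set of barycenters.\<close>

lemma barycenter_orbit_of_fixed:
  assumes "\<Gamma> \<noteq> {}" "\<forall>M \<in> \<Gamma>. M *v x = x"
  shows "barycenter (point_orbit \<Gamma> x) = x"
proof -
  have "point_orbit \<Gamma> x = {x}" using assms by (auto simp: point_orbit_def)
  then show ?thesis by (simp add: barycenter_def)
qed

theorem theorem15:
  fixes A :: "real ^ 'n ^ 'm" and b :: "real ^ 'm" and c :: "real ^ 'n"
    and \<Gamma> :: "(real ^ 'n ^ 'n) set" and \<gamma> :: "nat \<Rightarrow> real ^ 'n ^ 'n" and t :: nat
    and E :: "real ^ 'n ^ 'l" and A' :: "real ^ 'n ^ 'k" and b' :: "real ^ 'k"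
  assumes rows_nonzero: "\<forall>i. row i A \<noteq> 0"
    and c_nonzero: "c \<noteq> 0"
    and rows_hyperplanes: "inj (row_hyperplane A b)"
    and feasible_nonempty: "feasible A b \<noteq> {}"
    and has_optimum: "\<exists>x. optimal_solution A b c x"
    and feasible_bounded: "bounded (feasible A b)"
    and full_dimensional: "aff_dim (feasible A b) = int CARD('n)"
    and \<Gamma>_subgroup: "subgroup \<Gamma> (LP_Aut A b c)"
    and \<Gamma>_generated: "\<Gamma> = generate (LP_Aut A b c) (\<gamma> ` {1..t})"
    and \<Gamma>_finite: "finite \<Gamma>"
    and acts_on_rows: "\<forall>M \<in> \<Gamma>. \<forall>r \<in> ext_rows A b. row_act M r \<in> ext_rows A b"
    and kernel_E: "{x. E *v x = 0} = fixed_points \<Gamma> UNIV"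
    and orbit_sums: "orbit_sum_system \<Gamma> A b A' b'"
  shows "{x. A' *v x \<le> b' \<and> E *v x = 0} = fixed_points \<Gamma> (feasible A b)
    \<and> {x. A' *v x \<le> b' \<and> E *v x = 0} = {barycenter (point_orbit \<Gamma> x) | x. x \<in> feasible A b}
    \<and> (\<forall>x. optimal_solution (A' above E above - E) (b' above 0 above 0) c x
           \<longrightarrow> optimal_solution A b c x)
    \<and> (\<exists>x. optimal_solution (A' above E above - E) (b' above 0 above 0) c x)
    \<and> optimal_value (A' above E above - E) (b' above 0 above 0) c = optimal_value A b c"
proof -
  let ?P = "feasible A b"
  let ?P' = "{x. A' *v x \<le> b' \<and> E *v x = 0}"
  let ?A'' = "A' above E above - E" and ?b'' = "b' above 0 above 0"
  let ?\<beta> = "\<lambda>x. barycenter (point_orbit \<Gamma> x)"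

  have ne: "\<Gamma> \<noteq> {}"
    using subgroup.one_closed[OF \<Gamma>_subgroup] by auto
  have mult: "\<forall>M \<in> \<Gamma>. \<forall>N \<in> \<Gamma>. M ** N \<in> \<Gamma>"
    using subgroup.m_closed[OF \<Gamma>_subgroup] by (simp add: LP_Aut_def GL_def)
  have aut: "LP_automorphism A b c M" if "M \<in> \<Gamma>" for M
    using subgroup.subset[OF \<Gamma>_subgroup] that by (auto simp: LP_Aut_def)
  then have inv: "\<forall>M \<in> \<Gamma>. invertible M"
    and obj: "\<And>M x. M \<in> \<Gamma> \<Longrightarrow> x \<in> ?P \<Longrightarrow> c \<bullet> (M *v x) = c \<bullet> x"
    by (auto simp: LP_automorphism_def)
  have maps: "M *v x \<in> ?P" if "M \<in> \<Gamma>" "x \<in> ?P" for M x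
    using aut[OF that(1)] that(2) by (auto simp: LP_automorphism_def)

  have kernel: "E *v x = 0 \<longleftrightarrow> (\<forall>M \<in> \<Gamma>. M *v x = x)" for x
    using kernel_E by (auto simp: fixed_points_def)
  \<comment> \<open>The equation \<open>E *v x = 0\<close> makes \<open>x\<close> a fixed point,
    which is what allows orbit sums to replace the original rows.\<close>
  have "A' *v x \<le> b' \<longleftrightarrow> x \<in> ?P" if "E *v x = 0" for x
    using feasible_orbit_sum_system[OF orbit_sums \<Gamma>_finite ne inv] that
    by (simp add: kernel feasible_def)
  then have fixed: "?P' = fixed_points \<Gamma> ?P"
    by (auto simp: fixed_points_def kernel)

  have \<beta>_mem: "?\<beta> x \<in> fixed_points \<Gamma> ?P" and \<beta>_obj: "c \<bullet> ?\<beta> x = c \<bullet> x" if "x \<in> ?P" for x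
  proof -
    have S: "finite (point_orbit \<Gamma> x)" "point_orbit \<Gamma> x \<noteq> {}" "point_orbit \<Gamma> x \<subseteq> ?P"
      using \<Gamma>_finite ne maps that by (auto simp: point_orbit_def)
    show "?\<beta> x \<in> fixed_points \<Gamma> ?P"
      using barycenter_mem_convex[OF convex_feasible S] barycenter_fixed[OF \<Gamma>_finite mult] inv
      by (simp add: fixed_points_def)
    show "c \<bullet> ?\<beta> x = c \<bullet> x"
      using obj that by (intro inner_barycenter[OF S(1,2)]) (auto simp: point_orbit_def)
  qed
  have "x \<in> ?P \<and> x = ?\<beta> x" if "x \<in> fixed_points \<Gamma> ?P" for x
    using that barycenter_orbit_of_fixed[OF ne, of x] by (simp add: fixed_points_def)
  then have bary: "fixed_points \<Gamma> ?P = {?\<beta> x | x. x \<in> ?P}"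
    using \<beta>_mem by blast

  \<comment> \<open>Instantiating \<open>feasible_vstack\<close> at \<open>A'\<close> splits only
    the outermost stack and keeps the block of \<open>E\<close> and \<open>- E\<close> whole for
    \<open>feasible_eq_zero\<close>.\<close>
  have feas: "feasible ?A'' ?b'' = fixed_points \<Gamma> ?P"
    unfolding fixed[symmetric] feasible_vstack[of A'] feasible_eq_zero by (auto simp: feasible_def)
  then have opt: "optimal_solution ?A'' ?b'' c x \<longleftrightarrow> x \<in> fixed_points \<Gamma> ?P \<and> optimal_solution A b c x"
    for x
  proof -
    \<comment> \<open>The fixed points are the barycenters \<open>?\<beta> y\<close>, and each has
      the objective value of \<open>y\<close>. So both sets show the same objective values.\<close>
    have "(\<forall>y \<in> fixed_points \<Gamma> ?P. c \<bullet> y \<le> c \<bullet> x) \<longleftrightarrow> (\<forall>y \<in> ?P. c \<bullet> y \<le> c \<bullet> x)"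
      unfolding bary using \<beta>_obj by auto
    then show ?thesis
      by (auto simp: optimal_solution_def feas fixed_points_def)
  qed
  \<comment> \<open>Averaging an optimum of the original program over its orbit gives a point
    optimal for both programs, which settles solvability of the second and equality of the
    values.\<close>
  obtain x where x: "optimal_solution A b c x"
    using has_optimum by blast
  then have opt_\<beta>: "optimal_solution ?A'' ?b'' c (?\<beta> x)"
    unfolding opt using \<beta>_mem[of x] \<beta>_obj[of x] by (simp add: optimal_solution_def fixed_points_def)
  moreover have "optimal_value ?A'' ?b'' c = optimal_value A b c"
    unfolding optimal_value_eq[OF opt_\<beta>]
    using optimal_value_eq[of A b c "?\<beta> x"] opt_\<beta> opt by simp
  moreover have "optimal_solution A b c y" if "optimal_solution ?A'' ?b'' c y" for y
    using that opt by blast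
  ultimately show ?thesis
    using fixed trans[OF fixed bary] by blast
qed

end
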